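(* Let $n$ and $r$ be positive integers. If there exist $r$ mutually orthogonal idempotent latin squares of order $n$, then there exists an $r$-IPC$(n,n-1)$.
   Context: For permutations $\sigma,\tau$ of $[n]=\{1,\dots,n\}$, the Hamming distance is the number of $x$ with $\sigma(x)\neq\tau(x)$. A permutation code PC$(n,d)$ is a subset of $\mathcal{S}_n$ in which any two distinct elements are at Hamming distance at least $d$. A permutation code is idempotent if each of its words (permutations) has exactly one fixed point. An $r$-IPC$(n,n-1)$ is an idempotent PC$(n,n-1)$ on $[n]$ in which every symbol $i\in[n]$ is the fixed point of exactly $r$ words. A latin square $L$ of order $n$ on symbols $[n]$ is idempotent if its $(i,i)$-entry equals $i$ for each $i\in[n]$. Two latin squares are orthogonal if superimposing them yields every ordered pair of symbols exactly once. *)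

theory Defs
  imports Main "HOL-Library.FuncSet" "HOL-Combinatorics.Permutations"
begin

definition hamming_dist :: "nat \<Rightarrow> (nat \<Rightarrow> nat) \<Rightarrow> (nat \<Rightarrow> nat) \<Rightarrow> nat" where
  "hamming_dist n \<sigma> \<tau> = card {x \<in> {1..n}. \<sigma> x \<noteq> \<tau> x}"

definition is_PC :: "nat \<Rightarrow> nat \<Rightarrow> (nat \<Rightarrow> nat) set \<Rightarrow> bool" where
  "is_PC n d C \<longleftrightarrow>
     C \<subseteq> {\<sigma>. \<sigma> permutes {1..n}} \<and>
     (\<forall>\<sigma>\<in>C. \<forall>\<tau>\<in>C. \<sigma> \<noteq> \<tau> \<longrightarrow> d \<le> hamming_dist n \<sigma> \<tau>)"

text \<open>A function that permutes \<open>{1..n}\<close> is the identity outside \<open>{1..n}\<close>, so fixed points are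
  only counted inside \<open>{1..n}\<close>.\<close>

definition idempotent_code :: "nat \<Rightarrow> (nat \<Rightarrow> nat) set \<Rightarrow> bool" where
  "idempotent_code n C \<longleftrightarrow> (\<forall>\<sigma>\<in>C. \<exists>!x. x \<in> {1..n} \<and> \<sigma> x = x)"

definition is_IPC :: "nat \<Rightarrow> nat \<Rightarrow> nat \<Rightarrow> (nat \<Rightarrow> nat) set \<Rightarrow> bool" where
  "is_IPC r n d C \<longleftrightarrow>
     is_PC n d C \<and> idempotent_code n C \<and>
     (\<forall>i\<in>{1..n}. card {\<sigma> \<in> C. \<sigma> i = i} = r)"

text \<open>Squares are extensional functions on the cells \<open>{1..n} \<times> {1..n}\<close>, so that two squares are
  equal as functions exactly when their entries agree, and sets of squares have the right
  cardinality.\<close>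

definition latin_square :: "nat \<Rightarrow> (nat \<times> nat \<Rightarrow> nat) \<Rightarrow> bool" where
  "latin_square n L \<longleftrightarrow>
     L \<in> {1..n} \<times> {1..n} \<rightarrow>\<^sub>E {1..n} \<and>
     (\<forall>i\<in>{1..n}. bij_betw (\<lambda>j. L (i, j)) {1..n} {1..n}) \<and>
     (\<forall>j\<in>{1..n}. bij_betw (\<lambda>i. L (i, j)) {1..n} {1..n})"

definition idempotent_square :: "nat \<Rightarrow> (nat \<times> nat \<Rightarrow> nat) \<Rightarrow> bool" where
  "idempotent_square n L \<longleftrightarrow> (\<forall>i\<in>{1..n}. L (i, i) = i)"

definition orthogonal_squares ::
    "nat \<Rightarrow> (nat \<times> nat \<Rightarrow> nat) \<Rightarrow> (nat \<times> nat \<Rightarrow> nat) \<Rightarrow> bool" where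
  "orthogonal_squares n L M \<longleftrightarrow>
     (\<forall>a\<in>{1..n}. \<forall>b\<in>{1..n}. \<exists>!c. c \<in> {1..n} \<times> {1..n} \<and> L c = a \<and> M c = b)"

text \<open>The squares form a set, hence are distinct. For \<open>n \<ge> 2\<close> this is implied by orthogonality;
  for \<open>n = 1\<close> it excludes repetitions of the unique square of order 1, which is orthogonal to
  itself.\<close>

definition mutually_orthogonal_idempotent_latin_squares ::
    "nat \<Rightarrow> (nat \<times> nat \<Rightarrow> nat) set \<Rightarrow> bool" where
  "mutually_orthogonal_idempotent_latin_squares n S \<longleftrightarrow>
     (\<forall>L\<in>S. latin_square n L \<and> idempotent_square n L) \<and>
     pairwise (orthogonal_squares n) S"

end

theory Submission
  imports Defs
begin

text \<open>Each symbol \<open>i\<close> of a latin square \<open>L\<close> occupies the cells of a permutation \<open>\<sigma>\<close>, where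
  \<open>\<sigma> x\<close> is the column of \<open>i\<close> in row \<open>x\<close>. Idempotency makes \<open>i\<close> the only fixed point of \<open>\<sigma>\<close>.
  Permutations from the same square never agree, and those from two orthogonal squares
  with symbols \<open>i\<close> and \<open>j\<close> agree exactly once, namely in the row of the unique cell showing
  \<open>(i, j)\<close>.\<close>

definition symbol_perm :: "nat \<Rightarrow> (nat \<times> nat \<Rightarrow> nat) \<Rightarrow> nat \<Rightarrow> nat \<Rightarrow> nat" where
  "symbol_perm n L i x = (if x \<in> {1..n} then THE y. y \<in> {1..n} \<and> L (x, y) = i else x)"

lemma symbol_perm_cell:
  assumes "latin_square n L" "i \<in> {1..n}" "x \<in> {1..n}"
  shows "symbol_perm n L i x \<in> {1..n}" "L (x, symbol_perm n L i x) = i"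
proof -
  have "bij_betw (\<lambda>y. L (x, y)) {1..n} {1..n}"
    using assms unfolding latin_square_def by blast
  then have inj: "inj_on (\<lambda>y. L (x, y)) {1..n}" and "i \<in> (\<lambda>y. L (x, y)) ` {1..n}"
    using assms(2) by (simp_all add: bij_betw_def)
  then obtain y where "y \<in> {1..n}" "L (x, y) = i"
    by blast
  then have "\<exists>!y. y \<in> {1..n} \<and> L (x, y) = i"
    using inj_onD[OF inj] by (intro ex1I[of _ y]) auto
  from theI'[OF this] show "symbol_perm n L i x \<in> {1..n}" "L (x, symbol_perm n L i x) = i"
    using assms(3) by (auto simp: symbol_perm_def)
qed

lemma symbol_perm_eq_iff:
  assumes "latin_square n L" "i \<in> {1..n}" "x \<in> {1..n}" "y \<in> {1..n}"
  shows "symbol_perm n L i x = y \<longleftrightarrow> L (x, y) = i"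
proof -
  have "inj_on (\<lambda>y. L (x, y)) {1..n}"
    using assms unfolding latin_square_def by (blast dest: bij_betw_imp_inj_on)
  then show ?thesis
    using symbol_perm_cell[OF assms(1-3)] assms(4) by (metis (no_types, lifting) inj_onD)
qed

text \<open>Rows make the map well defined, columns make it injective: two rows sent to the same
  column would put \<open>i\<close> twice into that column.\<close>

lemma symbol_perm_permutes:
  assumes "latin_square n L" "i \<in> {1..n}"
  shows "symbol_perm n L i permutes {1..n}"
proof -
  let ?s = "symbol_perm n L i"
  have "inj_on ?s {1..n}"
  proof (rule inj_onI)
    fix x x' assume x: "x \<in> {1..n}" "x' \<in> {1..n}" and eq: "?s x = ?s x'"
    have "inj_on (\<lambda>x''. L (x'', ?s x)) {1..n}"
      using assms(1) symbol_perm_cell(1)[OF assms x(1)] unfolding latin_square_def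
      by (blast dest: bij_betw_imp_inj_on)
    moreover have "L (x, ?s x) = L (x', ?s x)"
      using symbol_perm_cell(2)[OF assms x(1)] symbol_perm_cell(2)[OF assms x(2)] eq by simp
    ultimately show "x = x'"
      using x by (metis (no_types, lifting) inj_onD)
  qed
  moreover have "?s ` {1..n} \<subseteq> {1..n}"
    using symbol_perm_cell(1)[OF assms] by blast
  ultimately have "bij_betw ?s {1..n} {1..n}"
    by (simp add: bij_betw_def endo_inj_surj)
  \<comment> \<open>Outside \<open>{1..n}\<close> the default value \<open>x\<close> in
    \<open>symbol_perm\<close> gives the identity, as \<open>permutes\<close> demands.\<close>
  then show ?thesis
    by (rule bij_imp_permutes) (simp only: symbol_perm_def if_False)
qed

text \<open>A fixed point \<open>x\<close> means that the diagonal cell \<open>(x, x)\<close> shows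
  \<open>i\<close>, but that cell shows \<open>x\<close>.\<close>

lemma symbol_perm_fixed_iff:
  assumes "latin_square n L" "idempotent_square n L" "i \<in> {1..n}" "x \<in> {1..n}"
  shows "symbol_perm n L i x = x \<longleftrightarrow> x = i"
  using assms symbol_perm_eq_iff[OF assms(1,3,4,4)] unfolding idempotent_square_def by simp

lemma symbol_perm_agree_card_le_1:
  assumes "latin_square n L" "latin_square n M" "i \<in> {1..n}" "j \<in> {1..n}"
    and "L = M \<Longrightarrow> i \<noteq> j" "L \<noteq> M \<Longrightarrow> orthogonal_squares n L M"
  shows "card {x \<in> {1..n}. symbol_perm n L i x = symbol_perm n M j x} \<le> 1"
proof -
  have "x = x'"
    if x: "x \<in> {1..n}" "symbol_perm n L i x = symbol_perm n M j x"
      and x': "x' \<in> {1..n}" "symbol_perm n L i x' = symbol_perm n M j x'" for x x'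
  proof -
    \<comment> \<open>An agreement in row \<open>x\<close> yields one cell of that row showing
      \<open>i\<close> in \<open>L\<close> and \<open>j\<close> in \<open>M\<close>.\<close>
    define c where "c = (x, symbol_perm n L i x)"
    define c' where "c' = (x', symbol_perm n L i x')"
    have c: "c \<in> {1..n} \<times> {1..n}" "L c = i" "M c = j"
      using symbol_perm_cell[OF assms(1,3) x(1)] symbol_perm_cell[OF assms(2,4) x(1)] x
      by (auto simp: c_def)
    have c': "c' \<in> {1..n} \<times> {1..n}" "L c' = i" "M c' = j"
      using symbol_perm_cell[OF assms(1,3) x'(1)] symbol_perm_cell[OF assms(2,4) x'(1)] x'
      by (auto simp: c'_def)
    \<comment> \<open>As soon as there is an agreement, \<open>L = M\<close> would give the cell
      \<open>c\<close> two different symbols.\<close>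
    have "L \<noteq> M"
      using assms(5) c by auto
    then have "\<exists>!c. c \<in> {1..n} \<times> {1..n} \<and> L c = i \<and> M c = j"
      using assms(3,4,6) unfolding orthogonal_squares_def by blast
    then have "c = c'"
      using c c' by blast
    then show ?thesis
      by (simp add: c_def c'_def)
  qed
  then show ?thesis
    by (intro card_le_Suc0_iff_eq[THEN iffD2, folded One_nat_def]) auto
qed

lemma hamming_dist_add_agree:
  "hamming_dist n \<sigma> \<tau> + card {x \<in> {1..n}. \<sigma> x = \<tau> x} = n"
proof -
  have "hamming_dist n \<sigma> \<tau> + card {x \<in> {1..n}. \<sigma> x = \<tau> x}
      = card ({x \<in> {1..n}. \<sigma> x \<noteq> \<tau> x} \<union> {x \<in> {1..n}. \<sigma> x = \<tau> x})"
    unfolding hamming_dist_def by (rule card_Un_disjoint[symmetric]) auto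
  also have "{x \<in> {1..n}. \<sigma> x \<noteq> \<tau> x} \<union> {x \<in> {1..n}. \<sigma> x = \<tau> x} = {1..n}"
    by auto
  finally show ?thesis by simp
qed

text \<open>Settles the case in which agreeing at most once does not separate two
  permutations.\<close>

lemma latin_square_order_1_unique:
  assumes "latin_square 1 L" "latin_square 1 M"
  shows "L = M"
proof (rule PiE_ext)
  show "L \<in> {1..1} \<times> {1..1} \<rightarrow>\<^sub>E {1..1}" "M \<in> {1..1} \<times> {1..1} \<rightarrow>\<^sub>E {1..1}"
    using assms by (auto simp: latin_square_def)
  then show "L c = M c" if "c \<in> {1..1} \<times> {1..1}" for c
    using that by (metis PiE_mem atLeastAtMost_singleton singletonD)
qed

text \<open>Ensures that different squares contribute different words fixing \<open>i\<close>. Equal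
  words agree in all \<open>n\<close> rows, so the bound on agreements leaves only order 1.\<close>

lemma inj_on_symbol_perm:
  assumes S: "mutually_orthogonal_idempotent_latin_squares n S" and i: "i \<in> {1..n}"
  shows "inj_on (\<lambda>L. symbol_perm n L i) S"
proof (rule inj_onI, rule ccontr)
  fix L M assume LM: "L \<in> S" "M \<in> S" "L \<noteq> M" and eq: "symbol_perm n L i = symbol_perm n M i"
  have latin: "latin_square n L" "latin_square n M"
    and orth: "orthogonal_squares n L M"
    using S LM unfolding mutually_orthogonal_idempotent_latin_squares_def
    by (auto dest: pairwiseD)
  have "card {x \<in> {1..n}. symbol_perm n L i x = symbol_perm n M i x} \<le> 1"
    using symbol_perm_agree_card_le_1[OF latin i i] LM(3) orth by blast
  moreover have "{x \<in> {1..n}. symbol_perm n L i x = symbol_perm n M i x} = {1..n}"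
    by (auto simp: eq)
  ultimately have "n \<le> 1"
    by simp
  then have "n = 1"
    using i by auto
  then show False
    using latin_square_order_1_unique latin LM(3) by blast
qed

lemma is_IPC_symbol_perms:
  assumes S: "mutually_orthogonal_idempotent_latin_squares n S"
  shows "is_IPC (card S) n (n - 1) {symbol_perm n L i |L i. L \<in> S \<and> i \<in> {1..n}}"
    (is "is_IPC _ _ _ ?C")
proof -
  have latin: "latin_square n L" and idem: "idempotent_square n L" if "L \<in> S" for L
    using S that unfolding mutually_orthogonal_idempotent_latin_squares_def by auto
  have orth: "orthogonal_squares n L M" if "L \<in> S" "M \<in> S" "L \<noteq> M" for L M
    using S that unfolding mutually_orthogonal_idempotent_latin_squares_def
    by (auto dest: pairwiseD)
  have "n - 1 \<le> hamming_dist n \<sigma> \<tau>" if C: "\<sigma> \<in> ?C" "\<tau> \<in> ?C" and neq: "\<sigma> \<noteq> \<tau>" for \<sigma> \<tau>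
  proof -
    obtain L i where L: "L \<in> S" "i \<in> {1..n}" "\<sigma> = symbol_perm n L i"
      using C(1) by blast
    obtain M j where M: "M \<in> S" "j \<in> {1..n}" "\<tau> = symbol_perm n M j"
      using C(2) by blast
    have "card {x \<in> {1..n}. \<sigma> x = \<tau> x} \<le> 1"
      unfolding L(3) M(3)
    proof (rule symbol_perm_agree_card_le_1[OF latin latin])
      \<comment> \<open>Distinct words differ in their square or in their symbol.\<close>
      show "i \<noteq> j" if "L = M"
        using that neq L(3) M(3) by auto
      show "orthogonal_squares n L M" if "L \<noteq> M"
        using orth[OF L(1) M(1) that] .
    qed (fact L M)+
    then show ?thesis
      using hamming_dist_add_agree[of n \<sigma> \<tau>] by linarith
  qed
  then have "is_PC n (n - 1) ?C"
    unfolding is_PC_def using symbol_perm_permutes latin by blast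
  moreover have "idempotent_code n ?C"
    unfolding idempotent_code_def using symbol_perm_fixed_iff latin idem by blast
  moreover have "card {\<sigma> \<in> ?C. \<sigma> i = i} = card S" if i: "i \<in> {1..n}" for i
  proof -
    \<comment> \<open>A word built from symbol \<open>j\<close> fixes only \<open>j\<close>, so the
      words fixing \<open>i\<close> are those built from \<open>i\<close>, one for each
      square.\<close>
    have "{\<sigma> \<in> ?C. \<sigma> i = i} = (\<lambda>L. symbol_perm n L i) ` S"
      using symbol_perm_fixed_iff[OF latin idem _ i] i by blast
    then show ?thesis
      using card_image[OF inj_on_symbol_perm[OF S i]] by simp
  qed
  ultimately show ?thesis
    unfolding is_IPC_def by blast
qed

theorem theorem2p3:
  fixes n r :: nat
  assumes "n \<ge> 1" and "r \<ge> 1"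
    and "\<exists>S. mutually_orthogonal_idempotent_latin_squares n S \<and> finite S \<and> card S = r"
  shows "\<exists>C. is_IPC r n (n - 1) C"
  using assms(3) is_IPC_symbol_perms by blast

end
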